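(* Let $X$ be a set and let $f$ be a bracketed word in $\mathfrak M(X)$. Let $(s_1,q_1)$ and $(s_2,q_2)$ be placements in $f$. Then: (a) $(s_1,q_1)$ and $(s_2,q_2)$ are separated in $f$ if and only if $(\phi(s_1),\phi_\star(q_1))$ and $(\phi(s_2),\phi_\star(q_2))$ are separated in $\phi(f)$; (b) $(s_1,q_1)$ and $(s_2,q_2)$ are nested in $f$ if and only if $(\phi(s_1),\phi_\star(q_1))$ and $(\phi(s_2),\phi_\star(q_2))$ are nested in $\phi(f)$; (c) $(s_1,q_1)$ and $(s_2,q_2)$ are intersecting in $f$ if and only if $(\phi(s_1),\phi_\star(q_1))$ and $(\phi(s_2),\phi_\star(q_2))$ are intersecting in $\phi(f)$.
   Context: Bracketed words. For a set $Y$, $M(Y)$ is the free monoid on $Y$, with unit (empty word) $1$. For a set $S$, $\lfloor S\rfloor=\{\lfloor s\rfloor\mid s\in S\}$ denotes a set indexed by $S$, disjoint from $S$ (and from the alphabet $Y$). Define $\mathfrak M_0(Y)=M(Y)$, $\mathfrak M_{n+1}(Y)=M(Y\cup\lfloor\mathfrak M_n(Y)\rfloor)$, with the natural inductively defined embeddings $\mathfrak M_n(Y)\hookrightarrow\mathfrak M_{n+1}(Y)$, and $\mathfrak M(Y)=\bigcup_{n\ge0}\mathfrak M_n(Y)$. Then $\mathfrak M(Y)=M(Y\cup\lfloor\mathfrak M(Y)\rfloor)$, with operator $w\mapsto\lfloor w\rfloor$, is the free operated monoid on $Y$ (an operated monoid is a monoid with a self-map; morphisms are monoid homomorphisms commuting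 with the self-maps). Its elements are called bracketed words. Motzkin words. Fix two symbols $\langle,\rangle$ not in any alphabet considered. A Motzkin word on $Y$ is a word in $M(Y\cup\{\langle,\rangle\})$ in which the numbers of $\langle$ and of $\rangle$ are equal and every prefix contains at least as many $\langle$ as $\rangle$. The set $\mathcal W(Y)$ of Motzkin words is an operated monoid under concatenation with operator $m\mapsto\langle m\rangle$. It is known that the unique morphism of operated monoids $\phi_Y:\mathfrak M(Y)\to\mathcal W(Y)$ with $\phi_Y(y)=y$ for $y\in Y$ is an isomorphism. Write $\phi=\phi_X$. Star words. Let $\star,\star_1,\star_2$ be distinct symbols not in $X\cup\{\langle,\rangle\}$. $\mathfrak M^\star(X)\subseteq\mathfrak M(X\cup\{\star\})$ consists of bracketed words with exactly one occurrence of $\star$; $\mathfrak M^{\star_1,\star_2}(X)\subseteq\mathfrak M(X\cup\{\star_1,\star_2\})$ of those with exactly one occurrence of each of $\star_1,\star_2$. For a set $Z$, $M^\star(Z)$ and $M^{\star_1,\star_2}(Z)$ are defined likewise as subsets of $M(Z\cup\{\star\})$ and $M(Z\cup\{\star_1,\star_2\})$. $\mathcal W^\star(X)$ is the set of words in $\mathcal W(X\cup\{\star\})$ with exactly one occurrence of $\star$. The map $\phi_\star:\mathfrak M^\star(X)\to\mathcal W^\star(X)$ is the bijection obtained by restricting $\phi_{X\cup\{\star\}}$. In all cases $q|_s$ denotes replacing $\star$ in $q$ by $s$, and $q|_{s_1,s_2}$ denotes replacing $\star_1$ by $s_1$ and $\star_2$ by $s_2$ (substituted words may contain star symbols). Placements.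 A placement in $f\in\mathfrak M(X)$ is a pair $(s,q)$ with $s\in\mathfrak M(X)$, $q\in\mathfrak M^\star(X)$, $f=q|_s$. A placement in $w\in\mathcal W(X)$ is a pair $(u,p)$ with $u\in\mathcal W(X)$, $p\in\mathcal W^\star(X)$, $w=p|_u$. If $(s,q)$ is a placement in $f$ then $(\phi(s),\phi_\star(q))$ is a placement in $\phi(f)$. Relative locations in a bracketed word. Placements $(s_1,q_1),(s_2,q_2)$ in $f\in\mathfrak M(X)$ are: separated if there is $q\in\mathfrak M^{\star_1,\star_2}(X)$ with $q_1|_{\star_1}=q|_{\star_1,s_2}$, $q_2|_{\star_2}=q|_{s_1,\star_2}$, $f=q|_{s_1,s_2}$; nested if there is $q\in\mathfrak M^\star(X)$ with $q_1=q_2|_q$ or $q_2=q_1|_q$; intersecting if there are $q\in\mathfrak M^\star(X)$ and $a,b,c\in\mathfrak M(X)\setminus\{1\}$ with either $f=q|_{abc}$, $q_1=q|_{\star c}$, $q_2=q|_{a\star}$, or $f=q|_{abc}$, $q_1=q|_{a\star}$, $q_2=q|_{\star c}$. Relative locations in a Motzkin word. Put $Z=X\cup\{\langle,\rangle\}$. Placements $(u_1,p_1),(u_2,p_2)$ in $w\in\mathcal W(X)$ are: separated if there is $p\in M^{\star_1,\star_2}(Z)$ with $w=p|_{u_1,u_2}$, $p_1|_{\star_1}=p|_{\star_1,u_2}$, $p_2|_{\star_2}=p|_{u_1,\star_2}$; nested if there is $p\in M^\star(Z)$ with $p_1=p_2|_p$ or $p_2=p_1|_p$; intersecting if there are $p\in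 M^\star(Z)$ and $a,b,c\in M(Z)\setminus\{1\}$ with either $w=p|_{abc}$, $p_1=p|_{\star c}$, $p_2=p|_{a\star}$, or $w=p|_{abc}$, $p_1=p|_{a\star}$, $p_2=p|_{\star c}$. *)

theory Defs
  imports "HOL-Library.Sublist"
begin

section \<open>Alphabets\<close>

text \<open>
  An arbitrary set \<open>X\<close> of letters is given as \<open>X :: 'a set\<close> and used as the alphabet \<open>Base ` X\<close>,
  so that the three star symbols are distinct from each other and from all letters of \<open>X\<close>.
  Words with and without stars live in one type, told apart by their alphabet, so the inclusion
  of the words on \<open>X\<close> into those on \<open>X \<union> {\<star>}\<close> is plain set inclusion.
\<close>

datatype 'a starred = Base 'a | Star | Star1 | Star2


section \<open>Bracketed words\<close>

text \<open>
  \<open>'a bsym\<close> contains the disjoint union of the letters and the symbols \<open>\<lfloor>w\<rfloor>\<close>. A bracketed word is a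
  list of these; the free monoid on a set \<open>S\<close> is \<^term>\<open>lists S\<close>, with concatenation and unit \<^term>\<open>[]\<close>.
\<close>

datatype 'a bsym = Letter 'a | Bracket "'a bsym list"

type_synonym 'a bword = "'a bsym list"

text \<open>
  The stages \<open>M\<^sub>n(Y)\<close> are sets in the one type \<open>'a bword\<close>, so the embeddings of each stage into
  the next are inclusions and the direct limit is a union.
\<close>

primrec bracketed_stage :: "nat \<Rightarrow> 'a set \<Rightarrow> 'a bword set" where
  "bracketed_stage 0 Y = lists (Letter ` Y)"
| "bracketed_stage (Suc n) Y = lists (Letter ` Y \<union> Bracket ` bracketed_stage n Y)"

definition bracketed_words :: "'a set \<Rightarrow> 'a bword set" where
  "bracketed_words Y = (\<Union>n. bracketed_stage n Y)"

primrec boccs_sym :: "'a \<Rightarrow> 'a bsym \<Rightarrow> nat" where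
  "boccs_sym y (Letter x) = (if x = y then 1 else 0)"
| "boccs_sym y (Bracket w) = sum_list (map (boccs_sym y) w)"

definition boccs :: "'a \<Rightarrow> 'a bword \<Rightarrow> nat" where
  "boccs y w = sum_list (map (boccs_sym y) w)"

definition star_bwords :: "'a set \<Rightarrow> 'a starred bword set" where
  "star_bwords X = {q \<in> bracketed_words (Base ` X \<union> {Star}). boccs Star q = 1}"

definition star2_bwords :: "'a set \<Rightarrow> 'a starred bword set" where
  "star2_bwords X =
     {q \<in> bracketed_words (Base ` X \<union> {Star1, Star2}). boccs Star1 q = 1 \<and> boccs Star2 q = 1}"

primrec bsubst_sym :: "('a \<Rightarrow> 'b bword) \<Rightarrow> 'a bsym \<Rightarrow> 'b bword" where
  "bsubst_sym \<sigma> (Letter x) = \<sigma> x"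
| "bsubst_sym \<sigma> (Bracket w) = [Bracket (concat (map (bsubst_sym \<sigma>) w))]"

definition bsubst :: "('a \<Rightarrow> 'b bword) \<Rightarrow> 'a bword \<Rightarrow> 'b bword" where
  "bsubst \<sigma> w = concat (map (bsubst_sym \<sigma>) w)"

definition bplug :: "'a starred bword \<Rightarrow> 'a starred bword \<Rightarrow> 'a starred bword" where
  "bplug q s = bsubst ((\<lambda>x. [Letter x])(Star := s)) q"

text \<open>Simultaneous substitution; the substituted words may themselves contain star symbols.\<close>

definition bplug2 ::
    "'a starred bword \<Rightarrow> 'a starred bword \<Rightarrow> 'a starred bword \<Rightarrow> 'a starred bword" where
  "bplug2 q s1 s2 = bsubst ((\<lambda>x. [Letter x])(Star1 := s1, Star2 := s2)) q"


section \<open>Motzkin words\<close>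

datatype 'a msym = MLetter 'a | LAngle | RAngle

type_synonym 'a mword = "'a msym list"

definition angle_alphabet :: "'a set \<Rightarrow> 'a msym set" where
  "angle_alphabet Y = MLetter ` Y \<union> {LAngle, RAngle}"

definition motzkin_words :: "'a set \<Rightarrow> 'a mword set" where
  "motzkin_words Y =
     {w \<in> lists (angle_alphabet Y).
        count_list w LAngle = count_list w RAngle \<and>
        (\<forall>u. prefix u w \<longrightarrow> count_list u RAngle \<le> count_list u LAngle)}"

definition angle :: "'a mword \<Rightarrow> 'a mword" where
  "angle w = LAngle # w @ [RAngle]"

definition star_motzkin_words :: "'a set \<Rightarrow> 'a starred mword set" where
  "star_motzkin_words X =
     {p \<in> motzkin_words (Base ` X \<union> {Star}). count_list p (MLetter Star) = 1}"

text \<open>Words of the free monoid with marked stars; they need not be Motzkin words.\<close>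

definition star_mwords :: "'a starred msym set \<Rightarrow> 'a starred mword set" where
  "star_mwords Z = {p \<in> lists (Z \<union> {MLetter Star}). count_list p (MLetter Star) = 1}"

definition star2_mwords :: "'a starred msym set \<Rightarrow> 'a starred mword set" where
  "star2_mwords Z =
     {p \<in> lists (Z \<union> {MLetter Star1, MLetter Star2}).
        count_list p (MLetter Star1) = 1 \<and> count_list p (MLetter Star2) = 1}"

definition mplug :: "'a starred mword \<Rightarrow> 'a starred mword \<Rightarrow> 'a starred mword" where
  "mplug p u = concat (map ((\<lambda>x. [x])(MLetter Star := u)) p)"

definition mplug2 ::
    "'a starred mword \<Rightarrow> 'a starred mword \<Rightarrow> 'a starred mword \<Rightarrow> 'a starred mword" where
  "mplug2 p u1 u2 = concat (map ((\<lambda>x. [x])(MLetter Star1 := u1, MLetter Star2 := u2)) p)"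


section \<open>From bracketed words to Motzkin words\<close>

text \<open>
  One polymorphic function restricts to \<open>\<phi>\<^sub>Y\<close> on the bracketed words on \<open>Y\<close>, for every alphabet \<open>Y\<close>;
  in particular it gives both \<open>\<phi> = \<phi>\<^sub>X\<close> and \<open>\<phi>\<^sub>\<star>\<close>. That it is the unique morphism fixing the
  letters is proved in \<open>phi_morphism\<close> and \<open>phi_unique\<close>.
\<close>

primrec phi_sym :: "'a bsym \<Rightarrow> 'a mword" where
  "phi_sym (Letter x) = [MLetter x]"
| "phi_sym (Bracket w) = angle (concat (map phi_sym w))"

definition phi :: "'a bword \<Rightarrow> 'a mword" where
  "phi w = concat (map phi_sym w)"

definition operated_morphism :: "'a set \<Rightarrow> ('a bword \<Rightarrow> 'a mword) \<Rightarrow> bool" where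
  "operated_morphism Y h \<longleftrightarrow>
     h ` bracketed_words Y \<subseteq> motzkin_words Y \<and>
     h [] = [] \<and>
     (\<forall>v\<in>bracketed_words Y. \<forall>w\<in>bracketed_words Y. h (v @ w) = h v @ h w) \<and>
     (\<forall>w\<in>bracketed_words Y. h [Bracket w] = angle (h w))"

lemma motzkin_Nil: "[] \<in> motzkin_words Y"
  by (simp add: motzkin_words_def)

lemma motzkin_letter: "y \<in> Y \<Longrightarrow> [MLetter y] \<in> motzkin_words Y"
  by (auto simp: motzkin_words_def angle_alphabet_def prefix_Cons)

lemma motzkin_append:
  "v \<in> motzkin_words Y \<Longrightarrow> w \<in> motzkin_words Y \<Longrightarrow> v @ w \<in> motzkin_words Y"
  by (auto simp: motzkin_words_def prefix_append)

lemma motzkin_angle: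
  assumes "w \<in> motzkin_words Y" shows "angle w \<in> motzkin_words Y"
  using assms
  by (auto simp: motzkin_words_def angle_def angle_alphabet_def prefix_Cons prefix_append
      le_SucI)

lemma phi_stage: "w \<in> bracketed_stage n Y \<Longrightarrow> phi w \<in> motzkin_words Y"
proof (induction n arbitrary: w)
  case 0
  then show ?case
    by (induction w) (auto simp: phi_def motzkin_Nil intro: motzkin_append[OF motzkin_letter, simplified])
next
  case (Suc n)
  from Suc.prems have "set w \<subseteq> Letter ` Y \<union> Bracket ` bracketed_stage n Y" by auto
  then show ?case
  proof (induction w)
    case Nil
    then show ?case by (simp add: phi_def motzkin_Nil)
  next
    case (Cons a w)
    have "phi_sym a \<in> motzkin_words Y"
      using Cons.prems Suc.IH by (auto simp: motzkin_letter phi_def intro!: motzkin_angle)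
    moreover have "phi w \<in> motzkin_words Y" using Cons by simp
    ultimately show ?case using motzkin_append by (fastforce simp: phi_def)
  qed
qed

lemma phi_words: "w \<in> bracketed_words Y \<Longrightarrow> phi w \<in> motzkin_words Y"
  by (auto simp: bracketed_words_def phi_stage)

theorem phi_morphism: "operated_morphism Y phi" "phi [Letter y] = [MLetter y]"
  by (auto simp: operated_morphism_def phi_words) (auto simp: phi_def)

theorem phi_unique:
  assumes h: "operated_morphism Y h" and letters: "\<And>y. y \<in> Y \<Longrightarrow> h [Letter y] = [MLetter y]"
    and w: "w \<in> bracketed_words Y"
  shows "h w = phi w"
proof -
  have stage: "v \<in> bracketed_words Y" if "v \<in> bracketed_stage n Y" for v n
    using that by (auto simp: bracketed_words_def)
  have happ: "h (v @ v') = h v @ h v'" if "v \<in> bracketed_words Y" "v' \<in> bracketed_words Y" for v v'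
    using h that by (auto simp: operated_morphism_def)
  have hbr: "h [Bracket v] = angle (h v)" if "v \<in> bracketed_words Y" for v
    using h that by (auto simp: operated_morphism_def)
  have hnil: "h [] = []" using h by (auto simp: operated_morphism_def)
  have "h w = phi w" if "w \<in> bracketed_stage n Y" for n w
    using that
  proof (induction n arbitrary: w)
    case 0
    from 0 have "set w \<subseteq> Letter ` Y" by auto
    then show ?case
    proof (induction w)
      case Nil
      then show ?case by (simp add: hnil phi_def)
    next
      case (Cons a w)
      have "h ([a] @ w) = h [a] @ h w"
        by (rule happ; rule stage[of _ 0]) (use Cons in auto)
      then show ?case using Cons by (auto simp: letters phi_def)
    qed
  next
    case (Suc n)
    from Suc.prems have "set w \<subseteq> Letter ` Y \<union> Bracket ` bracketed_stage n Y" by auto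
    then show ?case
    proof (induction w)
      case Nil
      then show ?case by (simp add: hnil phi_def)
    next
      case (Cons a w)
      have "h ([a] @ w) = h [a] @ h w"
        by (rule happ; rule stage[of _ "Suc n"]) (use Cons.prems in auto)
      moreover have "h [a] = phi_sym a"
        using Cons.prems Suc.IH by (auto simp: letters hbr stage phi_def)
      ultimately show ?case using Cons by (auto simp: phi_def)
    qed
  qed
  with w show ?thesis by (auto simp: bracketed_words_def)
qed


section \<open>Placements and relative locations\<close>

definition placement ::
    "'a set \<Rightarrow> 'a starred bword \<Rightarrow> 'a starred bword \<times> 'a starred bword \<Rightarrow> bool" where
  "placement X f = (\<lambda>(s, q).
     s \<in> bracketed_words (Base ` X) \<and> q \<in> star_bwords X \<and> f = bplug q s)"

definition motzkin_placement ::
    "'a set \<Rightarrow> 'a starred mword \<Rightarrow> 'a starred mword \<times> 'a starred mword \<Rightarrow> bool" where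
  "motzkin_placement X w = (\<lambda>(u, p).
     u \<in> motzkin_words (Base ` X) \<and> p \<in> star_motzkin_words X \<and> w = mplug p u)"

lemma count_phi: "count_list (phi w) (MLetter y) = boccs y w"
proof -
  have sym: "count_list (phi_sym a) (MLetter y) = boccs_sym y a" for a
  proof (induction a)
    case (Bracket w)
    then have "count_list (concat (map phi_sym w)) (MLetter y) = sum_list (map (boccs_sym y) w)"
      by (induction w) auto
    then show ?case by (simp add: angle_def)
  qed simp
  show ?thesis by (induction w) (auto simp: phi_def boccs_def sym)
qed

lemma phi_bplug: "phi (bplug q s) = mplug (phi q) (phi s)"
proof -
  let ?b = "bsubst_sym ((\<lambda>x. [Letter x])(Star := s))"
  have sym: "phi (?b a) = mplug (phi_sym a) (phi s)" for a
  proof (induction a)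
    case (Letter x)
    then show ?case by (simp add: mplug_def phi_def)
  next
    case (Bracket w)
    then have "phi (concat (map ?b w)) = mplug (concat (map phi_sym w)) (phi s)"
      by (induction w) (auto simp: phi_def mplug_def simp del: fun_upd_apply)
    moreover have "mplug (angle v) u = angle (mplug v u)" for v u :: "'a starred mword"
      by (simp add: mplug_def angle_def)
    ultimately show ?case by (simp add: phi_def del: fun_upd_apply)
  qed
  show ?thesis
    unfolding bplug_def bsubst_def
    by (induction q) (use sym in \<open>auto simp: phi_def mplug_def simp del: fun_upd_apply\<close>)
qed

theorem phi_placement:
  assumes "placement X f (s, q)"
  shows "motzkin_placement X (phi f) (phi s, phi q)"
  using assms
  by (auto simp: placement_def motzkin_placement_def star_bwords_def star_motzkin_words_def
      phi_words count_phi phi_bplug)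

text \<open>
  The six relations below presuppose that both pairs are placements in the given word;
  this is not repeated in the definitions.
\<close>

definition separated ::
    "'a set \<Rightarrow> 'a starred bword \<Rightarrow> 'a starred bword \<times> 'a starred bword \<Rightarrow>
     'a starred bword \<times> 'a starred bword \<Rightarrow> bool" where
  "separated X f = (\<lambda>(s1, q1) (s2, q2).
     \<exists>q\<in>star2_bwords X.
       bplug q1 [Letter Star1] = bplug2 q [Letter Star1] s2 \<and>
       bplug q2 [Letter Star2] = bplug2 q s1 [Letter Star2] \<and>
       f = bplug2 q s1 s2)"

definition nested ::
    "'a set \<Rightarrow> 'a starred bword \<Rightarrow> 'a starred bword \<times> 'a starred bword \<Rightarrow>
     'a starred bword \<times> 'a starred bword \<Rightarrow> bool" where
  "nested X f = (\<lambda>(s1, q1) (s2, q2).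
     \<exists>q\<in>star_bwords X. q1 = bplug q2 q \<or> q2 = bplug q1 q)"

definition intersecting ::
    "'a set \<Rightarrow> 'a starred bword \<Rightarrow> 'a starred bword \<times> 'a starred bword \<Rightarrow>
     'a starred bword \<times> 'a starred bword \<Rightarrow> bool" where
  "intersecting X f = (\<lambda>(s1, q1) (s2, q2).
     \<exists>q\<in>star_bwords X.
     \<exists>a\<in>bracketed_words (Base ` X) - {[]}.
     \<exists>b\<in>bracketed_words (Base ` X) - {[]}.
     \<exists>c\<in>bracketed_words (Base ` X) - {[]}.
       (f = bplug q (a @ b @ c) \<and>
        q1 = bplug q ([Letter Star] @ c) \<and> q2 = bplug q (a @ [Letter Star])) \<or>
       (f = bplug q (a @ b @ c) \<and>
        q1 = bplug q (a @ [Letter Star]) \<and> q2 = bplug q ([Letter Star] @ c)))"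

definition motzkin_separated ::
    "'a set \<Rightarrow> 'a starred mword \<Rightarrow> 'a starred mword \<times> 'a starred mword \<Rightarrow>
     'a starred mword \<times> 'a starred mword \<Rightarrow> bool" where
  "motzkin_separated X w = (\<lambda>(u1, p1) (u2, p2).
     \<exists>p\<in>star2_mwords (angle_alphabet (Base ` X)).
       w = mplug2 p u1 u2 \<and>
       mplug p1 [MLetter Star1] = mplug2 p [MLetter Star1] u2 \<and>
       mplug p2 [MLetter Star2] = mplug2 p u1 [MLetter Star2])"

definition motzkin_nested ::
    "'a set \<Rightarrow> 'a starred mword \<Rightarrow> 'a starred mword \<times> 'a starred mword \<Rightarrow>
     'a starred mword \<times> 'a starred mword \<Rightarrow> bool" where
  "motzkin_nested X w = (\<lambda>(u1, p1) (u2, p2).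
     \<exists>p\<in>star_mwords (angle_alphabet (Base ` X)). p1 = mplug p2 p \<or> p2 = mplug p1 p)"

definition motzkin_intersecting ::
    "'a set \<Rightarrow> 'a starred mword \<Rightarrow> 'a starred mword \<times> 'a starred mword \<Rightarrow>
     'a starred mword \<times> 'a starred mword \<Rightarrow> bool" where
  "motzkin_intersecting X w = (\<lambda>(u1, p1) (u2, p2).
     \<exists>p\<in>star_mwords (angle_alphabet (Base ` X)).
     \<exists>a\<in>lists (angle_alphabet (Base ` X)) - {[]}.
     \<exists>b\<in>lists (angle_alphabet (Base ` X)) - {[]}.
     \<exists>c\<in>lists (angle_alphabet (Base ` X)) - {[]}.
       (w = mplug p (a @ b @ c) \<and>
        p1 = mplug p ([MLetter Star] @ c) \<and> p2 = mplug p (a @ [MLetter Star])) \<or>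
       (w = mplug p (a @ b @ c) \<and>
        p1 = mplug p (a @ [MLetter Star]) \<and> p2 = mplug p ([MLetter Star] @ c)))"

end

theory Submission
  imports Defs
begin

text \<open>
  The map \<open>\<phi>\<close> is a bijection from bracketed words to Motzkin words that commutes with substitution,
  so a witness in the bracketed words is carried to a witness in the Motzkin words. For the converse,
  the words witnessing a relation between Motzkin placements, which a priori are arbitrary words,
  turn out to be Motzkin words: undoing the substitution of a Motzkin word for a letter preserves
  being Motzkin, and if \<open>ab\<close> and \<open>bc\<close> are Motzkin, then so are \<open>a\<close>, \<open>b\<close> and \<open>c\<close>.
\<close>

section \<open>Motzkin words\<close>

text \<open>Every symbol belongs to \<open>angle_alphabet UNIV\<close>, so
  \<open>motzkin_words UNIV\<close> captures the bracket condition alone. The arguments below use it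
  to treat balance separately from the alphabet.\<close>

lemma motzkin_words_UNIV_iff:
  "w \<in> motzkin_words UNIV \<longleftrightarrow> count_list w LAngle = count_list w RAngle \<and>
     (\<forall>u. prefix u w \<longrightarrow> count_list u RAngle \<le> count_list u LAngle)"
proof -
  have "angle_alphabet UNIV = (UNIV :: 'a msym set)"
    unfolding angle_alphabet_def by (metis UNIV_eq_I Un_iff insert_iff msym.exhaust rangeI)
  then show ?thesis by (simp add: motzkin_words_def)
qed

lemma motzkin_words_iff:
  "w \<in> motzkin_words Y \<longleftrightarrow> w \<in> lists (angle_alphabet Y) \<and> w \<in> motzkin_words UNIV"
  unfolding motzkin_words_UNIV_iff by (auto simp: motzkin_words_def)

lemma motzkin_cancel_left:
  assumes "v \<in> motzkin_words UNIV" "v @ w \<in> motzkin_words UNIV"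
  shows "w \<in> motzkin_words UNIV"
  unfolding motzkin_words_UNIV_iff
proof (intro conjI allI impI)
  show "count_list w LAngle = count_list w RAngle"
    using assms by (simp add: motzkin_words_UNIV_iff)
  fix u assume "prefix u w"
  then have "prefix (v @ u) (v @ w)" by simp
  then have "count_list (v @ u) RAngle \<le> count_list (v @ u) LAngle"
    using assms(2) unfolding motzkin_words_UNIV_iff by blast
  then show "count_list u RAngle \<le> count_list u LAngle"
    using assms(1) by (simp add: motzkin_words_UNIV_iff)
qed

text \<open>Call the number of \<open>LAngle\<close> minus the number of \<open>RAngle\<close> the
  excess. Prefixes of \<open>a\<close> are prefixes of \<open>a @ b\<close>, and prefixes of
  \<open>b\<close> are prefixes of \<open>b @ c\<close>, so none has negative excess. The excesses
  of \<open>a\<close> and \<open>b\<close> sum to zero, so both vanish; cancelling \<open>b\<close>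
  then settles \<open>c\<close>.\<close>

lemma motzkin_overlap:
  assumes ab: "a @ b \<in> motzkin_words UNIV" and bc: "b @ c \<in> motzkin_words UNIV"
  shows "a \<in> motzkin_words UNIV" "b \<in> motzkin_words UNIV" "c \<in> motzkin_words UNIV"
proof -
  have pa: "count_list u RAngle \<le> count_list u LAngle" if "prefix u a" for u
    using ab that prefix_prefix unfolding motzkin_words_UNIV_iff by blast
  have pb: "count_list u RAngle \<le> count_list u LAngle" if "prefix u b" for u
    using bc that prefix_prefix unfolding motzkin_words_UNIV_iff by blast
  have "count_list a LAngle + count_list b LAngle = count_list a RAngle + count_list b RAngle"
    using ab by (simp add: motzkin_words_UNIV_iff)
  then have "count_list a LAngle = count_list a RAngle" "count_list b LAngle = count_list b RAngle"
    using pa[of a] pb[of b] by auto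
  then show "a \<in> motzkin_words UNIV" and b: "b \<in> motzkin_words UNIV"
    using pa pb by (auto simp: motzkin_words_UNIV_iff)
  from b bc show "c \<in> motzkin_words UNIV" by (rule motzkin_cancel_left)
qed

text \<open>The shortest prefix of negative excess ends in \<open>RAngle\<close>, and what precedes
  it is Motzkin. Applied to the word after an opening bracket, this finds the matching closing
  bracket.\<close>

lemma motzkin_first_return:
  assumes "count_list w LAngle < count_list w RAngle"
  shows "\<exists>u v. w = u @ RAngle # v \<and> u \<in> motzkin_words UNIV"
  using assms
proof (induction w rule: length_induct)
  case (1 w)
  show ?case
  proof (cases "\<exists>t. strict_prefix t w \<and> count_list t LAngle < count_list t RAngle")
    case True
    then obtain t z where t: "w = t @ z" "length t < length w"
        "count_list t LAngle < count_list t RAngle"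
      by (metis prefixE prefix_length_less strict_prefix_def)
    with "1.IH" obtain u v where "t = u @ RAngle # v" "u \<in> motzkin_words UNIV" by blast
    with t show ?thesis by auto
  next
    case False
    from "1.prems" obtain xs x where w: "w = xs @ [x]" by (cases w rule: rev_cases) auto
    have p: "count_list t RAngle \<le> count_list t LAngle" if "prefix t xs" for t
    proof -
      from that w have "strict_prefix t w"
        by (metis append_self_conv not_Cons_self2 prefix_order.le_less_trans prefix_prefix
            prefix_snoc strict_prefix_def prefix_order.order_refl same_prefix_nil)
      with False show ?thesis by (meson not_less)
    qed
    \<comment> \<open>The excess is negative for \<open>w\<close> but not for \<open>xs\<close>, so
      the last letter takes it from 0 to -1.\<close>
    have "x = RAngle" "count_list xs LAngle = count_list xs RAngle"
      using p[of xs] "1.prems" w by (auto split: if_splits)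
    with p w show ?thesis by (auto simp: motzkin_words_UNIV_iff)
  qed
qed

text \<open>If \<open>u\<close> and \<open>u'\<close> differed, the shorter one followed by
  \<open>RAngle\<close> would be a prefix of the longer one, with more closing than opening
  brackets.\<close>

lemma motzkin_return_unique:
  assumes "u @ RAngle # v = u' @ RAngle # v'"
    and "u \<in> motzkin_words UNIV" "u' \<in> motzkin_words UNIV"
  shows "u = u' \<and> v = v'"
proof -
  have no: "\<not> prefix (x @ [RAngle]) y"
    if "x \<in> motzkin_words UNIV" "y \<in> motzkin_words UNIV" for x y :: "'a mword"
  proof
    assume "prefix (x @ [RAngle]) y"
    then have "count_list (x @ [RAngle]) RAngle \<le> count_list (x @ [RAngle]) LAngle"
      using that(2) unfolding motzkin_words_UNIV_iff by blast
    then show False using that(1) by (simp add: motzkin_words_UNIV_iff)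
  qed
  from assms(1) obtain t where
    "u = u' @ t \<and> t @ RAngle # v = RAngle # v' \<or> u @ t = u' \<and> RAngle # v = t @ RAngle # v'"
    by (auto simp: append_eq_append_conv2)
  then show ?thesis
    using no[OF assms(2,3)] no[OF assms(3,2)] by (cases t) auto
qed

text \<open>A nonempty Motzkin word starts with a letter or with a bracket pair around a Motzkin
  word, and the rest is Motzkin by left cancellation. These cases match the construction of
  bracketed words.\<close>

lemma motzkin_induct [consumes 1, case_names Nil Letter Angle]:
  assumes "w \<in> motzkin_words Y"
    and Nil: "P []"
    and Letter: "\<And>y w. y \<in> Y \<Longrightarrow> P w \<Longrightarrow> P (MLetter y # w)"
    and Angle: "\<And>u v. P u \<Longrightarrow> P v \<Longrightarrow> P (angle u @ v)"
  shows "P w"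
  using assms(1)
proof (induction w rule: length_induct)
  case (1 w)
  have mw: "w \<in> motzkin_words UNIV" and al: "w \<in> lists (angle_alphabet Y)"
    using "1.prems" motzkin_words_iff by blast+
  show ?case
  proof (cases w)
    case Nil
    with assms(2) show ?thesis by simp
  next
    case (Cons a z)
    show ?thesis
    proof (cases a)
      case (MLetter y)
      have "[MLetter y] \<in> motzkin_words UNIV" by (simp add: motzkin_letter)
      then have "z \<in> motzkin_words UNIV"
        using mw Cons MLetter motzkin_cancel_left[of "[MLetter y]" z] by simp
      moreover have "z \<in> lists (angle_alphabet Y)" "y \<in> Y"
        using al Cons MLetter by (auto simp: angle_alphabet_def)
      ultimately show ?thesis
        using Cons MLetter "1.IH" Letter motzkin_words_iff[of z Y] by auto
    next
      case RAngle
      have "prefix [RAngle] w" using Cons RAngle by simp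
      then show ?thesis using mw unfolding motzkin_words_UNIV_iff by fastforce
    next
      case LAngle
      \<comment> \<open>Dropping the opening bracket of a balanced word leaves excess -1, so a first
        return exists.\<close>
      have "count_list z LAngle < count_list z RAngle"
        using mw Cons LAngle by (simp add: motzkin_words_UNIV_iff)
      then obtain u v where z: "z = u @ RAngle # v" and u: "u \<in> motzkin_words UNIV"
        using motzkin_first_return by blast
      have w: "w = angle u @ v" using Cons LAngle z by (simp add: angle_def)
      have "v \<in> motzkin_words UNIV"
        using motzkin_cancel_left[OF motzkin_angle[OF u]] mw w by simp
      moreover have "u \<in> lists (angle_alphabet Y)" "v \<in> lists (angle_alphabet Y)"
        using al Cons z by auto
      ultimately have "P u" "P v"
        using "1.IH" u motzkin_words_iff[of u Y] motzkin_words_iff[of v Y] Cons z by auto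
      with Angle w show ?thesis by simp
    qed
  qed
qed


section \<open>Bijectivity of \<open>\<phi>\<close>\<close>

lemma phi_simps [simp]:
  "phi [] = []" "phi (Letter x # w) = MLetter x # phi w"
  "phi (Bracket v # w) = angle (phi v) @ phi w"
  by (simp_all add: phi_def)

lemma phi_append: "phi (v @ w) = phi v @ phi w"
  by (simp add: phi_def)

text \<open>Structural induction covers every value of the type, whatever its alphabet, so balance
  of images is available without tracking stages.\<close>

lemma phi_motzkin_UNIV: "phi w \<in> motzkin_words UNIV"
proof -
  have sym: "phi_sym a \<in> motzkin_words UNIV" for a :: "'a bsym"
  proof (induction a)
    case (Letter x)
    then show ?case by (simp add: motzkin_letter)
  next
    case (Bracket w)
    then have "concat (map phi_sym w) \<in> motzkin_words UNIV"
      by (induction w) (auto simp: motzkin_Nil intro: motzkin_append)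
    then show ?case by (simp add: motzkin_angle)
  qed
  show ?thesis
    by (induction w) (use sym in \<open>auto simp: phi_def motzkin_Nil intro: motzkin_append\<close>)
qed

text \<open>The first letter of the image shows whether the word starts with a letter or a bracket.
  In the bracket case uniqueness of the return separates the content from the rest, and both have
  shorter images.\<close>

lemma phi_inject: "phi v = phi w \<Longrightarrow> v = w"
proof (induction "length (phi v)" arbitrary: v w rule: less_induct)
  case less
  show ?case
  proof (cases v)
    case Nil
    with less.prems show ?thesis by (cases w rule: list.exhaust; cases "hd w") (auto simp: angle_def)
  next
    case (Cons a v')
    from less.prems Cons obtain b w' where w: "w = b # w'"
      by (cases w; cases a) (auto simp: angle_def)
    show ?thesis
    proof (cases a)
      case (Letter x)
      with less.prems Cons w have "b = Letter x" "phi v' = phi w'"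
        by (cases b; auto simp: angle_def)+
      moreover have "length (phi v') < length (phi v)" using Cons Letter by simp
      ultimately show ?thesis using less.hyps Cons w Letter by blast
    next
      case (Bracket c)
      with less.prems Cons w obtain d where d: "b = Bracket d"
        by (cases b) (auto simp: angle_def)
      have "phi c @ RAngle # phi v' = phi d @ RAngle # phi w'"
        using less.prems Cons w Bracket d by (simp add: angle_def)
      then have "phi c = phi d" "phi v' = phi w'"
        using motzkin_return_unique phi_motzkin_UNIV by blast+
      moreover have "length (phi c) < length (phi v)" "length (phi v') < length (phi v)"
        using Cons Bracket by (auto simp: angle_def)
      ultimately show ?thesis using less.hyps Cons w Bracket d by blast
    qed
  qed
qed

section \<open>Closure properties of bracketed words and surjectivity of \<open>phi\<close>\<close>

lemma bracketed_stage_mono: "m \<le> n \<Longrightarrow> bracketed_stage m Y \<subseteq> bracketed_stage n Y"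
proof (rule lift_Suc_mono_le)
  fix n show "bracketed_stage n Y \<subseteq> bracketed_stage (Suc n) Y"
  proof (induction n)
    case 0
    show ?case by (auto simp: lists_eq_set)
  next
    case (Suc n)
    then have "Letter ` Y \<union> Bracket ` bracketed_stage n Y
        \<subseteq> Letter ` Y \<union> Bracket ` bracketed_stage (Suc n) Y" by blast
    then show ?case unfolding bracketed_stage.simps(2) by (rule lists_mono)
  qed
qed

lemma bracketed_Nil: "[] \<in> bracketed_words Y"
  unfolding bracketed_words_def by (auto intro: exI[of _ 0])

lemma bracketed_Letter: "y \<in> Y \<Longrightarrow> [Letter y] \<in> bracketed_words Y"
  unfolding bracketed_words_def by (auto intro: exI[of _ 0])

lemma bracketed_Bracket:
  assumes "w \<in> bracketed_words Y" shows "[Bracket w] \<in> bracketed_words Y"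
proof -
  from assms obtain n where "w \<in> bracketed_stage n Y" by (auto simp: bracketed_words_def)
  then have "[Bracket w] \<in> bracketed_stage (Suc n) Y" by simp
  then show ?thesis unfolding bracketed_words_def by blast
qed

lemma bracketed_append:
  assumes "v \<in> bracketed_words Y" "w \<in> bracketed_words Y"
  shows "v @ w \<in> bracketed_words Y"
proof -
  from assms obtain m n where "v \<in> bracketed_stage m Y" "w \<in> bracketed_stage n Y"
    by (auto simp: bracketed_words_def)
  \<comment> \<open>Stages increase, so both words lie in a common stage, which is closed under
    concatenation.\<close>
  then have "v \<in> bracketed_stage (max m n) Y" "w \<in> bracketed_stage (max m n) Y"
    using bracketed_stage_mono by (meson max.cobounded1 max.cobounded2 subsetD)+
  then have "v @ w \<in> bracketed_stage (max m n) Y" by (cases "max m n") auto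
  then show ?thesis unfolding bracketed_words_def by blast
qed

lemma phi_surj:
  assumes "m \<in> motzkin_words Y"
  obtains w where "w \<in> bracketed_words Y" "phi w = m"
proof -
  from assms have "\<exists>w\<in>bracketed_words Y. phi w = m"
  proof (induction rule: motzkin_induct)
    case Nil
    show ?case using bracketed_Nil phi_simps(1) by blast
  next
    case (Letter y m)
    then obtain w where w: "w \<in> bracketed_words Y" "phi w = m" by blast
    show ?case
      using bracketed_append[OF bracketed_Letter[OF Letter(1)] w(1)] w(2)
      by (intro bexI[of _ "[Letter y] @ w"]) auto
  next
    case (Angle m n)
    then obtain v w where w: "v \<in> bracketed_words Y" "phi v = m" "w \<in> bracketed_words Y" "phi w = n"
      by blast
    show ?case
      using bracketed_append[OF bracketed_Bracket[OF w(1)] w(3)] w(2,4)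
      by (intro bexI[of _ "[Bracket v] @ w"]) auto
  qed
  with that show ?thesis by blast
qed


section \<open>Substitution\<close>

text \<open>Hypothesis \<open>g\<close>, stated without subtraction on \<open>nat\<close>, says that
  replacing a letter keeps its excess. Hence a prefix of \<open>p\<close> has the same excess as its
  image, which is a prefix of a Motzkin word. One- and two-star substitution are both
  instances.\<close>

lemma motzkin_concat_mapD:
  assumes g: "\<And>a. count_list (g a) LAngle + count_list [a] RAngle
                 = count_list (g a) RAngle + count_list [a] LAngle"
    and w: "concat (map g p) \<in> motzkin_words UNIV"
  shows "p \<in> motzkin_words UNIV"
proof -
  have c: "count_list (concat (map g r)) LAngle + count_list r RAngle
         = count_list (concat (map g r)) RAngle + count_list r LAngle" for r
  proof (induction r)
    case (Cons a r)
    then show ?case using g[of a] by auto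
  qed simp
  show ?thesis
    unfolding motzkin_words_UNIV_iff
  proof (intro conjI allI impI)
    show "count_list p LAngle = count_list p RAngle"
      using c[of p] w by (simp add: motzkin_words_UNIV_iff)
    fix u assume "prefix u p"
    then have "prefix (concat (map g u)) (concat (map g p))" by (auto simp: prefix_def)
    then have "count_list (concat (map g u)) RAngle \<le> count_list (concat (map g u)) LAngle"
      using w unfolding motzkin_words_UNIV_iff by blast
    then show "count_list u RAngle \<le> count_list u LAngle" using c[of u] by simp
  qed
qed

text \<open>The star and the Motzkin word replacing it both have excess zero.\<close>

lemma motzkin_mplugD:
  assumes "mplug p u \<in> motzkin_words UNIV" "u \<in> motzkin_words UNIV"
  shows "p \<in> motzkin_words UNIV"
  using assms(2) by (intro motzkin_concat_mapD[OF _ assms(1)[unfolded mplug_def]])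
    (auto simp: motzkin_words_UNIV_iff)

lemma motzkin_mplug2D:
  assumes "mplug2 p u v \<in> motzkin_words UNIV" "u \<in> motzkin_words UNIV" "v \<in> motzkin_words UNIV"
  shows "p \<in> motzkin_words UNIV"
  using assms(2,3) by (intro motzkin_concat_mapD[OF _ assms(1)[unfolded mplug2_def]])
    (auto simp: motzkin_words_UNIV_iff)

lemma mplug_append: "mplug (p @ r) u = mplug p u @ mplug r u"
  by (simp add: mplug_def)

lemma mplug_Star: "mplug [MLetter Star] u = u"
  by (simp add: mplug_def)

lemma mplug_mplug: "mplug (mplug p r) u = mplug p (mplug r u)"
  by (induction p) (auto simp: mplug_def)

lemma mplug_starless: "MLetter Star \<notin> set p \<Longrightarrow> mplug p u = p"
  by (induction p) (auto simp: mplug_def)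

text \<open>The single star splits \<open>p\<close> into starless words \<open>x\<close> and
  \<open>y\<close>, which cancel in \<open>x @ u @ y = x @ v @ y\<close>.\<close>

lemma mplug_inject:
  assumes "count_list p (MLetter Star) = 1" "mplug p u = mplug p v"
  shows "u = v"
proof -
  have "MLetter Star \<in> set p" using assms(1) by (metis count_notin zero_neq_one)
  then obtain x y where p: "p = x @ [MLetter Star] @ y" by (auto dest: split_list)
  with assms(1) have "MLetter Star \<notin> set x" "MLetter Star \<notin> set y"
    by (auto simp: count_list_0_iff)
  with assms(2) p show ?thesis by (simp add: mplug_append mplug_Star mplug_starless del: append.simps)
qed

lemma phi_bplug2: "phi (bplug2 q s1 s2) = mplug2 (phi q) (phi s1) (phi s2)"
proof -
  let ?b = "bsubst_sym ((\<lambda>x. [Letter x])(Star1 := s1, Star2 := s2))"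
  have sym: "phi (?b a) = mplug2 (phi_sym a) (phi s1) (phi s2)" for a
  proof (induction a)
    case (Letter x)
    then show ?case by (simp add: mplug2_def phi_def)
  next
    case (Bracket w)
    then have "phi (concat (map ?b w)) = mplug2 (concat (map phi_sym w)) (phi s1) (phi s2)"
      by (induction w) (auto simp: phi_def mplug2_def simp del: fun_upd_apply)
    moreover have "mplug2 (angle v) t u = angle (mplug2 v t u)" for v t u :: "'a starred mword"
      by (simp add: mplug2_def angle_def)
    ultimately show ?case by (simp add: phi_def del: fun_upd_apply)
  qed
  show ?thesis
    unfolding bplug2_def bsubst_def
    by (induction q) (use sym in \<open>auto simp: phi_def mplug2_def simp del: fun_upd_apply\<close>)
qed


section \<open>Transfer of relative locations\<close>

lemma angle_alphabet_insert: "angle_alphabet (insert y Y) = insert (MLetter y) (angle_alphabet Y)"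
  by (auto simp: angle_alphabet_def)

lemma star_mwords_phi:
  "q \<in> star_bwords X \<Longrightarrow> phi q \<in> star_mwords (angle_alphabet (Base ` X))"
  using phi_words[of q "Base ` X \<union> {Star}"] motzkin_words_iff[of "phi q" "Base ` X \<union> {Star}"]
  by (auto simp: star_bwords_def star_mwords_def count_phi angle_alphabet_insert)

lemma star2_mwords_phi:
  "q \<in> star2_bwords X \<Longrightarrow> phi q \<in> star2_mwords (angle_alphabet (Base ` X))"
  using phi_words[of q "Base ` X \<union> {Star1, Star2}"]
    motzkin_words_iff[of "phi q" "Base ` X \<union> {Star1, Star2}"]
  by (auto simp: star2_bwords_def star2_mwords_def count_phi angle_alphabet_insert)

text \<open>A witness for a Motzkin relation is an arbitrary word with one star. Once it is known to
  be Motzkin it has a preimage, and \<open>count_phi\<close> carries the number of stars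
  back.\<close>

lemma star_mwords_phiE:
  assumes "p \<in> star_mwords (angle_alphabet (Base ` X))" "p \<in> motzkin_words UNIV"
  obtains q where "q \<in> star_bwords X" "phi q = p"
proof -
  from assms have "p \<in> motzkin_words (Base ` X \<union> {Star})"
    by (subst motzkin_words_iff) (simp add: star_mwords_def angle_alphabet_insert)
  then obtain q where q: "q \<in> bracketed_words (Base ` X \<union> {Star})" "phi q = p"
    by (rule phi_surj)
  with assms(1) that show ?thesis
    by (simp add: star_mwords_def star_bwords_def flip: count_phi)
qed

lemma star2_mwords_phiE:
  assumes "p \<in> star2_mwords (angle_alphabet (Base ` X))" "p \<in> motzkin_words UNIV"
  obtains q where "q \<in> star2_bwords X" "phi q = p"
proof -
  from assms have "p \<in> motzkin_words (Base ` X \<union> {Star1, Star2})"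
    by (subst motzkin_words_iff) (simp add: star2_mwords_def angle_alphabet_insert insert_commute)
  then obtain q where q: "q \<in> bracketed_words (Base ` X \<union> {Star1, Star2})" "phi q = p"
    by (rule phi_surj)
  with assms(1) that show ?thesis
    by (simp add: star2_mwords_def star2_bwords_def flip: count_phi)
qed

section \<open>Separated placements\<close>

lemma separated_iff:
  "separated X f (s1, q1) (s2, q2) \<longleftrightarrow>
   motzkin_separated X (phi f) (phi s1, phi q1) (phi s2, phi q2)"
proof
  assume "separated X f (s1, q1) (s2, q2)"
  then obtain q where q: "q \<in> star2_bwords X"
    "bplug q1 [Letter Star1] = bplug2 q [Letter Star1] s2"
    "bplug q2 [Letter Star2] = bplug2 q s1 [Letter Star2]" "f = bplug2 q s1 s2"
    by (auto simp: separated_def)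
  have "mplug (phi q1) [MLetter Star1] = mplug2 (phi q) [MLetter Star1] (phi s2)"
       "mplug (phi q2) [MLetter Star2] = mplug2 (phi q) (phi s1) [MLetter Star2]"
    using arg_cong[OF q(2), of phi] arg_cong[OF q(3), of phi]
    by (simp_all add: phi_bplug phi_bplug2)
  with q show "motzkin_separated X (phi f) (phi s1, phi q1) (phi s2, phi q2)"
    by (auto simp: motzkin_separated_def phi_bplug2 intro!: bexI[OF _ star2_mwords_phi])
next
  assume "motzkin_separated X (phi f) (phi s1, phi q1) (phi s2, phi q2)"
  then obtain p where p: "p \<in> star2_mwords (angle_alphabet (Base ` X))"
    "phi f = mplug2 p (phi s1) (phi s2)"
    "mplug (phi q1) [MLetter Star1] = mplug2 p [MLetter Star1] (phi s2)"
    "mplug (phi q2) [MLetter Star2] = mplug2 p (phi s1) [MLetter Star2]"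
    by (auto simp: motzkin_separated_def)
  \<comment> \<open>Filling both stars of \<open>p\<close> with Motzkin words gives the Motzkin word
    \<open>phi f\<close>, so \<open>p\<close> is itself Motzkin.\<close>
  have "mplug2 p (phi s1) (phi s2) \<in> motzkin_words UNIV"
    using p(2) phi_motzkin_UNIV by metis
  then have "p \<in> motzkin_words UNIV" by (rule motzkin_mplug2D) (rule phi_motzkin_UNIV)+
  with p(1) obtain q where q: "q \<in> star2_bwords X" "phi q = p" by (rule star2_mwords_phiE)
  \<comment> \<open>Each equation holds after applying \<open>phi\<close>, which commutes with
    substitution and is injective.\<close>
  have "f = bplug2 q s1 s2"
       "bplug q1 [Letter Star1] = bplug2 q [Letter Star1] s2"
       "bplug q2 [Letter Star2] = bplug2 q s1 [Letter Star2]"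
    by (rule phi_inject; simp add: phi_bplug phi_bplug2 p q)+
  with q(1) show "separated X f (s1, q1) (s2, q2)" by (auto simp: separated_def)
qed

section \<open>Nested placements\<close>

lemma nested_phiE:
  assumes "placement X f (s1, q1)" "placement X f (s2, q2)"
    and p: "p \<in> star_mwords (angle_alphabet (Base ` X))" "phi q1 = mplug (phi q2) p"
  obtains q where "q \<in> star_bwords X" "q1 = bplug q2 q"
proof -
  \<comment> \<open>Both sides equal \<open>phi f\<close>: the right one is \<open>phi q1\<close>
    filled with \<open>phi s1\<close>, by associativity of substitution. Cancelling
    \<open>phi q2\<close> shows that \<open>p\<close> filled with \<open>phi s1\<close> is the
    Motzkin word \<open>phi s2\<close>.\<close>
  have "mplug (phi q2) (phi s2) = mplug (phi q2) (mplug p (phi s1))"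
    using assms(1,2) p(2) by (simp add: placement_def phi_bplug flip: mplug_mplug) (metis phi_bplug)
  moreover have "count_list (phi q2) (MLetter Star) = 1"
    using assms(2) by (simp add: placement_def star_bwords_def count_phi)
  ultimately have "mplug p (phi s1) = phi s2" by (metis mplug_inject)
  then have "p \<in> motzkin_words UNIV"
    using motzkin_mplugD phi_motzkin_UNIV by metis
  with p(1) obtain q where q: "q \<in> star_bwords X" "phi q = p" by (rule star_mwords_phiE)
  have "q1 = bplug q2 q" by (rule phi_inject) (simp add: phi_bplug p q)
  with q(1) show ?thesis by (rule that)
qed

lemma nested_iff:
  assumes "placement X f (s1, q1)" "placement X f (s2, q2)"
  shows "nested X f (s1, q1) (s2, q2) \<longleftrightarrow>
    motzkin_nested X (phi f) (phi s1, phi q1) (phi s2, phi q2)"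
proof
  assume "nested X f (s1, q1) (s2, q2)"
  then show "motzkin_nested X (phi f) (phi s1, phi q1) (phi s2, phi q2)"
    unfolding nested_def motzkin_nested_def by (auto simp: phi_bplug intro: star_mwords_phi)
next
  assume "motzkin_nested X (phi f) (phi s1, phi q1) (phi s2, phi q2)"
  then obtain p where "p \<in> star_mwords (angle_alphabet (Base ` X))"
    "phi q1 = mplug (phi q2) p \<or> phi q2 = mplug (phi q1) p"
    by (auto simp: motzkin_nested_def)
  then have "\<exists>q\<in>star_bwords X. q1 = bplug q2 q \<or> q2 = bplug q1 q"
    using nested_phiE[OF assms(1,2)] nested_phiE[OF assms(2,1)] by blast
  then show "nested X f (s1, q1) (s2, q2)" by (simp add: nested_def)
qed

section \<open>Intersecting placements\<close>

definition overlaps where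
  "overlaps X f q1 q2 \<longleftrightarrow>
     (\<exists>q\<in>star_bwords X.
      \<exists>a\<in>bracketed_words (Base ` X) - {[]}.
      \<exists>b\<in>bracketed_words (Base ` X) - {[]}.
      \<exists>c\<in>bracketed_words (Base ` X) - {[]}.
        f = bplug q (a @ b @ c) \<and>
        q1 = bplug q ([Letter Star] @ c) \<and> q2 = bplug q (a @ [Letter Star]))"

definition motzkin_overlaps where
  "motzkin_overlaps X w p1 p2 \<longleftrightarrow>
     (\<exists>p\<in>star_mwords (angle_alphabet (Base ` X)).
      \<exists>a\<in>lists (angle_alphabet (Base ` X)) - {[]}.
      \<exists>b\<in>lists (angle_alphabet (Base ` X)) - {[]}.
      \<exists>c\<in>lists (angle_alphabet (Base ` X)) - {[]}.
        w = mplug p (a @ b @ c) \<and>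
        p1 = mplug p ([MLetter Star] @ c) \<and> p2 = mplug p (a @ [MLetter Star]))"

text \<open>The two alternatives in the definition differ by exchanging the placements, so it
  suffices to transfer one orientation.\<close>

lemma intersecting_overlaps:
  "intersecting X f (s1, q1) (s2, q2) \<longleftrightarrow> overlaps X f q1 q2 \<or> overlaps X f q2 q1"
  unfolding intersecting_def overlaps_def prod.case by blast

lemma motzkin_intersecting_overlaps:
  "motzkin_intersecting X w (u1, p1) (u2, p2) \<longleftrightarrow>
     motzkin_overlaps X w p1 p2 \<or> motzkin_overlaps X w p2 p1"
  unfolding motzkin_intersecting_def motzkin_overlaps_def prod.case by blast

lemma overlaps_phi:
  assumes "overlaps X f q1 q2"
  shows "motzkin_overlaps X (phi f) (phi q1) (phi q2)"
proof -
  from assms obtain q a b c where q: "q \<in> star_bwords X"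
    and abc: "a \<in> bracketed_words (Base ` X) - {[]}" "b \<in> bracketed_words (Base ` X) - {[]}"
      "c \<in> bracketed_words (Base ` X) - {[]}"
    and eq: "f = bplug q (a @ b @ c)" "q1 = bplug q ([Letter Star] @ c)"
      "q2 = bplug q (a @ [Letter Star])"
    unfolding overlaps_def by blast
  \<comment> \<open>Nonempty words stay nonempty because \<open>phi\<close> is injective and fixes
    the empty word.\<close>
  have mem: "phi v \<in> lists (angle_alphabet (Base ` X)) - {[]}"
    if "v \<in> bracketed_words (Base ` X) - {[]}" for v
    using that phi_words[of v "Base ` X"] motzkin_words_iff[of "phi v" "Base ` X"]
      phi_inject[of v "[]"] by auto
  have "phi f = mplug (phi q) (phi a @ phi b @ phi c)"
    "phi q1 = mplug (phi q) ([MLetter Star] @ phi c)"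
    "phi q2 = mplug (phi q) (phi a @ [MLetter Star])"
    by (simp_all add: eq phi_bplug phi_append)
  with star_mwords_phi[OF q] abc[THEN mem] show ?thesis
    unfolding motzkin_overlaps_def by blast
qed

lemma motzkin_overlaps_phi:
  assumes pl: "placement X f (s1, q1)" "placement X f (s2, q2)"
    and "motzkin_overlaps X (phi f) (phi q1) (phi q2)"
  shows "overlaps X f q1 q2"
proof -
  let ?A = "angle_alphabet (Base ` X)"
  from assms(3) obtain p a b c where p: "p \<in> star_mwords ?A"
    and abc: "a \<in> lists ?A - {[]}" "b \<in> lists ?A - {[]}" "c \<in> lists ?A - {[]}"
    and eq: "phi f = mplug p (a @ b @ c)" "phi q1 = mplug p ([MLetter Star] @ c)"
      "phi q2 = mplug p (a @ [MLetter Star])"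
    unfolding motzkin_overlaps_def by blast
  have star: "MLetter Star \<notin> ?A" by (auto simp: angle_alphabet_def)
  \<comment> \<open>Filling the star of \<open>phi q1\<close> or \<open>phi q2\<close> leaves the
    flanking words \<open>c\<close> and \<open>a\<close> unchanged.\<close>
  have starless: "mplug a u = a" "mplug c u = c" for u
    using abc star by (auto intro!: mplug_starless)
  have f: "phi f = mplug (phi q1) (phi s1)" "phi f = mplug (phi q2) (phi s2)"
    using pl by (auto simp: placement_def simp flip: phi_bplug)
  have "mplug p (phi s1 @ c) = mplug p (a @ b @ c)"
    using f(1) eq(1) unfolding eq(2) mplug_mplug mplug_append mplug_Star starless by simp
  moreover have "mplug p (a @ phi s2) = mplug p (a @ b @ c)"
    using f(2) eq(1) unfolding eq(3) mplug_mplug mplug_append mplug_Star starless by simp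
  moreover have "count_list p (MLetter Star) = 1" using p by (simp add: star_mwords_def)
  \<comment> \<open>Cancelling the context \<open>p\<close> identifies the placed words:
    \<open>phi s1 = a @ b\<close> and \<open>phi s2 = b @ c\<close>. Both are Motzkin and overlap in
    \<open>b\<close>, so all three pieces are Motzkin.\<close>
  ultimately have "phi s1 @ c = (a @ b) @ c" "a @ phi s2 = a @ b @ c"
    using mplug_inject by (metis append.assoc)+
  then have "a @ b \<in> motzkin_words UNIV" "b @ c \<in> motzkin_words UNIV"
    using phi_motzkin_UNIV[of s1] phi_motzkin_UNIV[of s2] by simp_all
  note mot = motzkin_overlap[OF this]
  \<comment> \<open>With \<open>a @ b @ c\<close> Motzkin, undoing its substitution in
    \<open>phi f\<close> makes the context \<open>p\<close> Motzkin too.\<close>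
  have "mplug p (a @ b @ c) \<in> motzkin_words UNIV" using eq(1) phi_motzkin_UNIV by metis
  then have "p \<in> motzkin_words UNIV" by (rule motzkin_mplugD) (intro motzkin_append mot)
  with p obtain q where q: "q \<in> star_bwords X" "phi q = p" by (rule star_mwords_phiE)
  have preim: "\<exists>v'\<in>bracketed_words (Base ` X) - {[]}. phi v' = v"
    if "v \<in> lists ?A - {[]}" "v \<in> motzkin_words UNIV" for v
    using that phi_surj[of v "Base ` X"] motzkin_words_iff[of v "Base ` X"]
    by (metis DiffD1 DiffD2 DiffI phi_simps(1) singleton_iff)
  obtain a' b' c' where abc': "a' \<in> bracketed_words (Base ` X) - {[]}" "phi a' = a"
      "b' \<in> bracketed_words (Base ` X) - {[]}" "phi b' = b"
      "c' \<in> bracketed_words (Base ` X) - {[]}" "phi c' = c"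
    using preim[OF abc(1) mot(1)] preim[OF abc(2) mot(2)] preim[OF abc(3) mot(3)] by blast
  have "f = bplug q (a' @ b' @ c')" "q1 = bplug q ([Letter Star] @ c')"
      "q2 = bplug q (a' @ [Letter Star])"
    by (rule phi_inject; simp add: eq phi_bplug phi_append q abc')+
  with q(1) abc'(1,3,5) show ?thesis unfolding overlaps_def by blast
qed

lemma intersecting_iff:
  assumes "placement X f (s1, q1)" "placement X f (s2, q2)"
  shows "intersecting X f (s1, q1) (s2, q2) \<longleftrightarrow>
    motzkin_intersecting X (phi f) (phi s1, phi q1) (phi s2, phi q2)"
  unfolding intersecting_overlaps motzkin_intersecting_overlaps
  \<comment> \<open>The second orientation is the first with the two placements exchanged.\<close>
  using overlaps_phi motzkin_overlaps_phi[OF assms] motzkin_overlaps_phi[OF assms(2,1)] by blast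

theorem theorem4p10:
  fixes X :: "'a set" and f s1 q1 s2 q2 :: "'a starred bword"
  assumes "f \<in> bracketed_words (Base ` X)"
    and "placement X f (s1, q1)"
    and "placement X f (s2, q2)"
  shows "(separated X f (s1, q1) (s2, q2) \<longleftrightarrow>
            motzkin_separated X (phi f) (phi s1, phi q1) (phi s2, phi q2)) \<and>
         (nested X f (s1, q1) (s2, q2) \<longleftrightarrow>
            motzkin_nested X (phi f) (phi s1, phi q1) (phi s2, phi q2)) \<and>
         (intersecting X f (s1, q1) (s2, q2) \<longleftrightarrow>
            motzkin_intersecting X (phi f) (phi s1, phi q1) (phi s2, phi q2))"
  using separated_iff nested_iff intersecting_iff assms(2,3) by blast

end
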